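(* Let $n$ be a positive integer and let $A=A_s+A_d\epsilon$ be an $n\times n$ dual number matrix, where $A_s$ is a real primitive matrix and $A_d$ is a real matrix. Let $\lambda=\lambda_s+\lambda_d\epsilon$ be the Perron eigenvalue of $A$. Then for any $n$-dimensional positive dual number vector $\mathbf{x}$, we have $$\min_i\frac{(A\mathbf{x})_i}{x_i}\le\lambda\le\max_i\frac{(A\mathbf{x})_i}{x_i}.$$ Furthermore, $$\max_{\mathbf{x}>\mathbf{0}}\min_i\frac{(A\mathbf{x})_i}{x_i}=\lambda=\min_{\mathbf{x}>\mathbf{0}}\max_i\frac{(A\mathbf{x})_i}{x_i},$$ where $\mathbf{x}$ ranges over the $n$-dimensional positive dual number vectors.
   Context: A dual number is $a=a_s+a_d\epsilon$ with $a_s,a_d\in\mathbb{R}$ (standard part, dual part), where $\epsilon\neq0$, $\epsilon^2=0$; $a+b=(a_s+b_s)+(a_d+b_d)\epsilon$, $ab=a_sb_s+(a_sb_d+a_db_s)\epsilon$, and if $b_s\ne0$ then $\frac{a}{b}=\frac{a_s}{b_s}+\left(\frac{a_d}{b_s}-\frac{a_s}{b_s}\frac{b_d}{b_s}\right)\epsilon$. Dual numbers are totally ordered by: $a>b$ if $a_s>b_s$, or $a_s=b_s$ and $a_d>b_d$; all inequalities, minima and maxima between dual numbers use this order. A dual number vector is called positive (written $\mathbf{x}>\mathbf{0}$) if its standard part is entrywise positive. A real square matrix $A_s$ is primitive if $A_s\ge O$ entrywise and some power $A_s^m$ ($m\ge1$) is entrywise positive. A dual complex number (same definition with complex parts) $\lambda$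 is an eigenvalue of $A$ with eigenvector $\mathbf{x}=\mathbf{x}_s+\mathbf{x}_d\epsilon$ if $A\mathbf{x}=\lambda\mathbf{x}$ and $\mathbf{x}_s\ne\mathbf{0}$. When $A_s$ is primitive, the Perron eigenvalue of $A$ is the unique eigenvalue $\lambda=\lambda_s+\lambda_d\epsilon$ of $A$ whose standard part $\lambda_s$ is the spectral radius of $A_s$; it is a dual number, with $\lambda_d=\frac{\mathbf{y}_s^\top A_d\mathbf{x}_s}{\mathbf{y}_s^\top\mathbf{x}_s}$, where $\mathbf{x}_s,\mathbf{y}_s$ are entrywise positive real eigenvectors of $A_s$ and $A_s^\top$ for $\lambda_s$. *)

theory Defs
  imports "Jordan_Normal_Form.Spectral_Radius"
begin

section \<open>Dual numbers\<close>

text \<open>\<open>Dual a b\<close> is $a + b\epsilon$; the dual numbers are \<open>real dual\<close> and the dual complex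
  numbers are \<open>complex dual\<close>.\<close>

datatype 'a dual = Dual (std_part: 'a) (dual_part: 'a)

instantiation dual :: (comm_ring_1) comm_ring_1
begin

definition "0 = Dual 0 0"
definition "1 = Dual 1 0"
definition "a + b = Dual (std_part a + std_part b) (dual_part a + dual_part b)"
definition "a - b = Dual (std_part a - std_part b) (dual_part a - dual_part b)"
definition "- a = Dual (- std_part a) (- dual_part a)"
definition "a * b = Dual (std_part a * std_part b)
                         (std_part a * dual_part b + dual_part a * std_part b)"

instance
  by standard
    (simp_all add: zero_dual_def one_dual_def plus_dual_def minus_dual_def uminus_dual_def
       times_dual_def dual.expand algebra_simps)

end

text \<open>Division is only meaningful if the denominator has a nonzero standard part.\<close>

instantiation dual :: (field) inverse
begin

definition "a div b = Dual (std_part a / std_part b)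
  (dual_part a / std_part b - std_part a / std_part b * (dual_part b / std_part b))"
definition "inverse a = (1 :: 'a dual) div a"

instance ..

end

lemma dual_divide_times:
  fixes a b :: "'a :: field dual"
  assumes "std_part b \<noteq> 0"
  shows "a / b * b = a"
  using assms by (cases a) (simp add: divide_dual_def times_dual_def field_simps)

instantiation dual :: (linorder) linorder
begin

definition "a \<le> b \<longleftrightarrow>
  std_part a < std_part b \<or> (std_part a = std_part b \<and> dual_part a \<le> dual_part b)"
definition "a < b \<longleftrightarrow>
  std_part a < std_part b \<or> (std_part a = std_part b \<and> dual_part a < dual_part b)"

instance
  by standard (auto simp: less_eq_dual_def less_dual_def intro: dual.expand)

end

section \<open>Dual matrices and the Perron eigenvalue\<close>

definition positive_dual_vec :: "real dual vec \<Rightarrow> bool" where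
  "positive_dual_vec x \<longleftrightarrow> (\<forall>i < dim_vec x. 0 < std_part (x $ i))"

definition primitive_mat :: "real mat \<Rightarrow> bool" where
  "primitive_mat A \<longleftrightarrow> square_mat A \<and>
     (\<forall>i < dim_row A. \<forall>j < dim_col A. 0 \<le> A $$ (i, j)) \<and>
     (\<exists>m \<ge> 1. \<forall>i < dim_row A. \<forall>j < dim_col A. 0 < (A ^\<^sub>m m) $$ (i, j))"

definition dual_eigenvalue :: "'a :: comm_ring_1 dual mat \<Rightarrow> 'a dual \<Rightarrow> bool" where
  "dual_eigenvalue A l \<longleftrightarrow>
     (\<exists>x \<in> carrier_vec (dim_row A).
        map_vec std_part x \<noteq> 0\<^sub>v (dim_row A) \<and> A *\<^sub>v x = l \<cdot>\<^sub>v x)"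

abbreviation complex_dual :: "real dual \<Rightarrow> complex dual" where
  "complex_dual \<equiv> map_dual complex_of_real"

text \<open>Eigenvalues of a dual number matrix are dual complex numbers.  The Perron eigenvalue is
  the dual number that is the one and only dual complex eigenvalue whose standard part is the
  spectral radius of the standard part of the matrix.\<close>

definition perron_eigenvalue :: "real dual mat \<Rightarrow> real dual" where
  "perron_eigenvalue A = (THE l.
     {\<mu>. dual_eigenvalue (map_mat complex_dual A) \<mu> \<and>
         std_part \<mu> =
           complex_of_real (spectral_radius (map_mat complex_of_real (map_mat std_part A)))}
     = {complex_dual l})"

section \<open>Collatz--Wielandt quotients\<close>

definition min_ratio :: "real dual mat \<Rightarrow> real dual vec \<Rightarrow> real dual" where
  "min_ratio A x = Min ((\<lambda>i. (A *\<^sub>v x) $ i / x $ i) ` {..<dim_vec x})"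

definition max_ratio :: "real dual mat \<Rightarrow> real dual vec \<Rightarrow> real dual" where
  "max_ratio A x = Max ((\<lambda>i. (A *\<^sub>v x) $ i / x $ i) ` {..<dim_vec x})"

text \<open>Attained extrema of possibly infinite sets (\<open>Max\<close> and \<open>Min\<close> are for finite sets only).\<close>

definition is_maximum :: "'a :: order set \<Rightarrow> 'a \<Rightarrow> bool" where
  "is_maximum S m \<longleftrightarrow> m \<in> S \<and> (\<forall>s \<in> S. s \<le> m)"

definition is_minimum :: "'a :: order set \<Rightarrow> 'a \<Rightarrow> bool" where
  "is_minimum S m \<longleftrightarrow> m \<in> S \<and> (\<forall>s \<in> S. m \<le> s)"

end

theory Submission
  imports Defs
begin

text \<open>
  The whole theorem follows from a pair of positive dual vectors \<open>x\<close>, \<open>y\<close> with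
  \<open>A x = l x\<close> and \<open>A\<^sup>T y = l y\<close>.  The lexicographic order makes the dual numbers an ordered
  ring (with zero divisors, but a factor with positive standard part can be cancelled).  If
  \<open>m u\<^sub>i \<le> (A u)\<^sub>i\<close> for all \<open>i\<close>, multiply by \<open>y\<^sub>i \<ge> 0\<close> and sum: this gives
  \<open>m (y \<bullet> u) \<le> y \<bullet> A u = l (y \<bullet> u)\<close>, and \<open>y \<bullet> u\<close> has positive standard part, so
  \<open>m \<le> l\<close>; the other bound is the same argument with the inequalities reversed.  Both extrema are
  attained at \<open>x\<close>, where all quotients equal \<open>l\<close>.

  The pairing with \<open>y\<close> also identifies \<open>l\<close> as the Perron eigenvalue.  If \<open>A z = \<mu> z\<close> over the
  dual complex numbers and the standard part of \<open>\<mu>\<close> is the spectral radius \<open>r\<close> of the standard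
  part \<open>B\<close> of \<open>A\<close>, then \<open>l (y \<bullet> z) = \<mu> (y \<bullet> z)\<close>, and \<open>y \<bullet> z\<close> may be cancelled because the
  standard part of \<open>z\<close> is a nonzero multiple of that of \<open>x\<close>.

  It remains to produce the vectors.  Their standard parts come from Perron--Frobenius theory,
  which reduces here to one fact (\<open>primitive_subinvariant\<close>): a nonzero vector \<open>u \<ge> 0\<close> with
  \<open>B u \<ge> r u\<close> is an eigenvector and is positive.  It applies to the entrywise modulus of every
  eigenvector whose eigenvalue has modulus \<open>r\<close>, which yields existence; and since such an
  eigenvector has no zero entry, subtracting a multiple of \<open>x\<close> that kills one entry yields
  uniqueness up to scaling.  The dual part \<open>v\<close> of an eigenvector has to solve
  \<open>(B - r) v = w\<close> for a right hand side \<open>w\<close> that is orthogonal to the left eigenvector by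
  the choice of the dual part of \<open>l\<close>; this is solvable because \<open>r\<close> is a simple eigenvalue
  (\<open>simple_eigenvalue_solvable\<close>).
\<close>

section \<open>The dual numbers as an ordered ring\<close>

lemma std_part_simps [simp]:
  "std_part 0 = 0" "std_part 1 = 1"
  "std_part (a + b) = std_part a + std_part b"
  "std_part (a * b) = std_part a * std_part b"
  by (simp_all add: zero_dual_def one_dual_def plus_dual_def times_dual_def)

lemma dual_part_simps [simp]:
  "dual_part 0 = 0" "dual_part 1 = 0"
  "dual_part (a + b) = dual_part a + dual_part b"
  "dual_part (a * b) = std_part a * dual_part b + dual_part a * std_part b"
  by (simp_all add: zero_dual_def one_dual_def plus_dual_def times_dual_def)

interpretation std_part_hom: comm_ring_hom "std_part :: 'a :: comm_ring_1 dual \<Rightarrow> 'a"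
  by unfold_locales simp_all

interpretation dual_part_hom: comm_monoid_add_hom "dual_part :: 'a :: comm_ring_1 dual \<Rightarrow> 'a"
  by unfold_locales simp_all

interpretation complex_dual_hom: comm_ring_hom complex_dual
  by unfold_locales (auto intro!: dual.expand simp: dual.map_sel)

text \<open>The order is compatible with multiplication only in the weak sense: \<open>c = \<epsilon>\<close> is positive,
  and multiplying by it identifies numbers that differ only in the dual part.\<close>

instance dual :: (linordered_idom) ordered_comm_ring
proof
  fix a b c :: "'a dual"
  show "a \<le> b \<Longrightarrow> c + a \<le> c + b"
    by (auto simp: less_eq_dual_def)
  assume "a \<le> b" "0 \<le> c"
  then show "c * a \<le> c * b"
    by (auto simp: less_eq_dual_def mult_left_mono)
qed

lemma std_part_pos_imp_nonneg: "0 < std_part (a :: 'a :: linordered_idom dual) \<Longrightarrow> 0 \<le> a"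
  by (simp add: less_eq_dual_def)

lemma dual_le_of_mult_right_le:
  fixes a b c :: "'a :: linordered_idom dual"
  assumes "a * c \<le> b * c" "0 < std_part c"
  shows "a \<le> b"
  using assms by (auto simp: less_eq_dual_def)

lemma dual_mult_right_cancel:
  fixes a b c :: "'a :: idom dual"
  assumes "a * c = b * c" "std_part c \<noteq> 0"
  shows "a = b"
proof (rule dual.expand, intro conjI)
  have std: "std_part a * std_part c = std_part b * std_part c"
    using arg_cong[OF assms(1), of std_part] by simp
  then show s: "std_part a = std_part b" using assms(2) by simp
  show "dual_part a = dual_part b"
    using arg_cong[OF assms(1), of dual_part] assms(2) s by simp
qed

lemma dual_part_mult_mat_vec:
  assumes "A \<in> carrier_mat n m" "x \<in> carrier_vec m"
  shows "map_vec dual_part (A *\<^sub>v x) =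
    map_mat std_part A *\<^sub>v map_vec dual_part x + map_mat dual_part A *\<^sub>v map_vec std_part x"
  using assms
  by (intro eq_vecI) (auto simp: scalar_prod_def dual_part_hom.hom_sum sum.distrib)

section \<open>Nonnegative and primitive matrices\<close>

lemma nonneg_mat_mult_vec_mono:
  fixes B :: "real mat"
  assumes "B \<in> carrier_mat n m" "u \<in> carrier_vec m" "v \<in> carrier_vec m"
    and "\<And>i j. i < n \<Longrightarrow> j < m \<Longrightarrow> 0 \<le> B $$ (i, j)"
    and "\<And>j. j < m \<Longrightarrow> u $ j \<le> v $ j" and "i < n"
  shows "(B *\<^sub>v u) $ i \<le> (B *\<^sub>v v) $ i"
  using assms by (auto simp: scalar_prod_def intro!: sum_mono mult_left_mono)

lemma pos_mat_mult_vec_pos: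
  fixes B :: "real mat"
  assumes "B \<in> carrier_mat n m" "u \<in> carrier_vec m"
    and "\<And>i j. i < n \<Longrightarrow> j < m \<Longrightarrow> 0 < B $$ (i, j)"
    and "\<And>j. j < m \<Longrightarrow> 0 \<le> u $ j" and "u \<noteq> 0\<^sub>v m" and "i < n"
  shows "0 < (B *\<^sub>v u) $ i"
proof -
  obtain k where k: "k < m" "u $ k \<noteq> 0"
    using assms(2,5) by (metis carrier_vecD eq_vecI index_zero_vec(1,2))
  then have "0 < u $ k" using assms(4)[of k] by simp
  then have "0 < (\<Sum>j = 0..<m. B $$ (i, j) * u $ j)"
    using assms(3,4,6) k
    by (intro sum_pos2[of _ k]) (auto intro!: mult_pos_pos mult_nonneg_nonneg less_imp_le[OF assms(3)])
  then show ?thesis using assms by (simp add: scalar_prod_def)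
qed

lemma pow_mat_comm:
  assumes "(B :: 'a :: semiring_1 mat) \<in> carrier_mat n n"
  shows "B ^\<^sub>m k * B = B * B ^\<^sub>m k"
  using assms by (induction k) (auto simp: assoc_mult_mat[of _ n n _ n _ n])

lemma transpose_pow_mat:
  assumes "(B :: 'a :: comm_semiring_1 mat) \<in> carrier_mat n n"
  shows "transpose_mat B ^\<^sub>m k = transpose_mat (B ^\<^sub>m k)"
proof (induction k)
  case 0
  then show ?case using assms by simp
next
  case (Suc k)
  have "transpose_mat (B ^\<^sub>m Suc k) = transpose_mat (B * B ^\<^sub>m k)"
    using pow_mat_comm[OF assms] by simp
  also have "\<dots> = transpose_mat (B ^\<^sub>m k) * transpose_mat B"
    using assms by (intro transpose_mult) auto
  finally show ?case using Suc by simp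
qed

lemma primitive_mat_transpose:
  assumes "primitive_mat B"
  shows "primitive_mat (transpose_mat B)"
proof -
  define n where "n = dim_row B"
  have B: "B \<in> carrier_mat n n"
    using assms by (auto simp: primitive_mat_def n_def)
  obtain m where m: "m \<ge> 1" "\<And>i j. i < n \<Longrightarrow> j < n \<Longrightarrow> 0 < (B ^\<^sub>m m) $$ (i, j)"
    using assms B unfolding primitive_mat_def by (metis carrier_matD)
  have "0 < (transpose_mat B ^\<^sub>m m) $$ (i, j)" if "i < n" "j < n" for i j
    unfolding transpose_pow_mat[OF B] using m(2)[OF that(2,1)] that B
    by simp
  then show ?thesis
    using assms B m(1) unfolding primitive_mat_def by auto
qed

section \<open>Perron--Frobenius theory of primitive matrices\<close>

abbreviation real_spectral_radius :: "real mat \<Rightarrow> real" where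
  "real_spectral_radius B \<equiv> spectral_radius (map_mat complex_of_real B)"

lemma real_spectral_radius_nonneg:
  assumes "B \<in> carrier_mat n n" "n > 0"
  shows "0 \<le> real_spectral_radius B"
  using spectral_radius_mem_max(1)[of "map_mat complex_of_real B" n] assms by auto

lemma spectrum_smult:
  fixes C :: "'a :: field mat"
  assumes C: "C \<in> carrier_mat n n" and c: "c \<noteq> 0" and e: "e \<in> spectrum (c \<cdot>\<^sub>m C)"
  shows "e / c \<in> spectrum C"
proof -
  obtain v where v: "v \<in> carrier_vec n" "v \<noteq> 0\<^sub>v n" "(c \<cdot>\<^sub>m C) *\<^sub>v v = e \<cdot>\<^sub>v v"
    using e C unfolding spectrum_def eigenvalue_def eigenvector_def by auto
  have "C *\<^sub>v v = (e / c) \<cdot>\<^sub>v v"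
  proof (rule eq_vecI)
    fix i assume i: "i < dim_vec ((e / c) \<cdot>\<^sub>v v)"
    then have "((c \<cdot>\<^sub>m C) *\<^sub>v v) $ i = e * v $ i" unfolding v(3) by simp
    moreover have "((c \<cdot>\<^sub>m C) *\<^sub>v v) $ i = c * (C *\<^sub>v v) $ i"
      using i v(1) C by (simp add: scalar_prod_def sum_distrib_left mult.assoc)
    ultimately show "(C *\<^sub>v v) $ i = ((e / c) \<cdot>\<^sub>v v) $ i"
      using c i by (simp add: field_simps)
  qed (use v C in auto)
  then show ?thesis using v C unfolding spectrum_def eigenvalue_def eigenvector_def by auto
qed

text \<open>Otherwise pick \<open>t\<close> strictly between the spectral radius and \<open>s\<close>.  The powers of \<open>D = B / t\<close>
  are bounded, because its spectral radius is below \<open>1\<close>; but \<open>D w \<ge> (s / t) w\<close> iterates to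
  \<open>D\<^sup>k w \<ge> (s / t)\<^sup>k w\<close>, which grows exponentially.\<close>

lemma le_spectral_radius_of_le_mult_vec:
  fixes B :: "real mat"
  assumes B: "B \<in> carrier_mat n n" and n: "n > 0" and w: "w \<in> carrier_vec n"
    and nonneg: "\<And>i j. i < n \<Longrightarrow> j < n \<Longrightarrow> 0 \<le> B $$ (i, j)"
    and pos: "\<And>i. i < n \<Longrightarrow> 0 < w $ i"
    and le: "\<And>i. i < n \<Longrightarrow> s * w $ i \<le> (B *\<^sub>v w) $ i"
  shows "s \<le> real_spectral_radius B"
proof (rule ccontr)
  let ?C = "map_mat complex_of_real B"
  assume "\<not> ?thesis"
  then obtain t where t: "real_spectral_radius B < t" "t < s"
    using dense by (meson not_le)
  then have t0: "0 < t" using real_spectral_radius_nonneg[OF B n] by simp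
  define D where "D = (1 / t) \<cdot>\<^sub>m B"
  have D: "D \<in> carrier_mat n n" using B by (simp add: D_def)
  have Dc: "map_mat complex_of_real D = complex_of_real (1 / t) \<cdot>\<^sub>m ?C"
    by (rule eq_matI) (auto simp: D_def)
  \<comment> \<open>Rescaling by \<open>1 / t\<close> brings the spectral radius below \<open>1\<close>.\<close>
  have "real_spectral_radius D \<in> norm ` spectrum (map_mat complex_of_real D)"
    using D n by (intro spectral_radius_mem_max) auto
  then obtain e where e: "e \<in> spectrum (map_mat complex_of_real D)"
    "real_spectral_radius D = norm e" by auto
  have "e / complex_of_real (1 / t) \<in> spectrum ?C"
    using e(1)[unfolded Dc] t0 B by (intro spectrum_smult[of _ n]) auto
  then have "norm (e / complex_of_real (1 / t)) \<le> real_spectral_radius B"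
    using B n by (intro spectral_radius_mem_max(2)[of _ n]) auto
  then have "norm e * t \<le> real_spectral_radius B"
    using t0 by (simp add: norm_divide norm_mult)
  then have "norm e * t < 1 * t" using t by simp
  then have "real_spectral_radius D < 1" using e(2) t0 by (simp only: mult_less_cancel_right_pos)
  then obtain c where c: "\<And>k. norm_bound (map_mat complex_of_real D ^\<^sub>m k) c"
    using spectral_radius_jnf_norm_bound_less_1_upper_triangular D by (metis map_carrier_mat)
  have bnd: "(D ^\<^sub>m k) $$ (i, j) \<le> c" if "i < n" "j < n" for k i j
  proof -
    have "norm (map_mat complex_of_real (D ^\<^sub>m k) $$ (i, j)) \<le> c"
      using c[of k] that D unfolding of_real_hom.mat_hom_pow[OF D, symmetric] norm_bound_def
      by auto
    then show ?thesis using that D by simp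
  qed
  have growth: "(s / t) ^ k * w $ i \<le> (D ^\<^sub>m k *\<^sub>v w) $ i" if "i < n" for k i
    using that
  proof (induction k arbitrary: i)
    case 0
    then show ?case using w D by simp
  next
    case (Suc k)
    have Dw: "s / t * w $ j \<le> (D *\<^sub>v w) $ j" if "j < n" for j
      using le[OF that] that t0 w B by (simp add: D_def field_simps)
    have Dn: "0 \<le> D $$ (a, b)" if "a < n" "b < n" for a b
      using nonneg that t0 B by (simp add: D_def)
    have "(s / t) ^ Suc k * w $ i = (s / t) ^ k * (s / t * w $ i)" by simp
    also have "\<dots> \<le> (s / t) ^ k * (D *\<^sub>v w) $ i"
      using Dw[OF Suc.prems] t t0 by (intro mult_left_mono) auto
    also have "\<dots> = (D *\<^sub>v ((s / t) ^ k \<cdot>\<^sub>v w)) $ i"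
      using mult_mat_vec[OF D w] Suc.prems D w by (simp)
    also have "\<dots> \<le> (D *\<^sub>v (D ^\<^sub>m k *\<^sub>v w)) $ i"
      using Suc D w Dn mult_mat_vec_carrier[OF pow_carrier_mat[OF D] w]
      by (intro nonneg_mat_mult_vec_mono[of _ n n]) auto
    also have "D *\<^sub>v (D ^\<^sub>m k *\<^sub>v w) = D ^\<^sub>m Suc k *\<^sub>v w"
      using assoc_mult_mat_vec[OF D pow_carrier_mat[OF D] w] pow_mat_comm[OF D] by simp
    finally show ?case .
  qed
  define S where "S = (\<Sum>j = 0..<n. c * w $ j)"
  have "(s / t) ^ k \<le> S / w $ 0" for k
  proof -
    have "(s / t) ^ k * w $ 0 \<le> (D ^\<^sub>m k *\<^sub>v w) $ 0" by (rule growth[OF n])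
    also have "\<dots> \<le> S"
      using D w n bnd pos unfolding S_def
      by (auto simp: scalar_prod_def less_imp_le intro!: sum_mono mult_right_mono)
    finally show ?thesis using pos[OF n] by (simp add: field_simps)
  qed
  moreover obtain k where "S / w $ 0 < (s / t) ^ k"
    using real_arch_pow[of "s / t"] t t0 by auto
  ultimately show False by (meson not_le)
qed

text \<open>Let \<open>P\<close> be a positive power of \<open>B\<close>, and \<open>w = P u\<close>, which is positive.  If \<open>B u - r u \<ge> 0\<close> is
  nonzero, then \<open>P\<close> makes it positive, that is, \<open>B w > r w\<close> in every entry.  Finitely many entries
  leave room for some \<open>s > r\<close> with \<open>B w \<ge> s w\<close>, contrary to
  \<open>le_spectral_radius_of_le_mult_vec\<close>.
  Once \<open>B u = r u\<close>, the positive vector \<open>w\<close> is a multiple of \<open>u\<close>, so \<open>u\<close> is positive too.\<close>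

lemma primitive_subinvariant:
  fixes B :: "real mat"
  assumes B: "B \<in> carrier_mat n n" and n: "n > 0" and prim: "primitive_mat B"
    and u: "u \<in> carrier_vec n" "u \<noteq> 0\<^sub>v n" and nonneg: "\<And>i. i < n \<Longrightarrow> 0 \<le> u $ i"
    and le: "\<And>i. i < n \<Longrightarrow> real_spectral_radius B * u $ i \<le> (B *\<^sub>v u) $ i"
  shows "B *\<^sub>v u = real_spectral_radius B \<cdot>\<^sub>v u" and "\<And>i. i < n \<Longrightarrow> 0 < u $ i"
proof -
  define r where "r = real_spectral_radius B"
  have Bn: "\<And>i j. i < n \<Longrightarrow> j < n \<Longrightarrow> 0 \<le> B $$ (i, j)"
    using prim B by (auto simp: primitive_mat_def)
  obtain m where m: "\<And>i j. i < n \<Longrightarrow> j < n \<Longrightarrow> 0 < (B ^\<^sub>m m) $$ (i, j)"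
    using prim B unfolding primitive_mat_def by (metis carrier_matD)
  define P where "P = B ^\<^sub>m m"
  have P: "P \<in> carrier_mat n n" using B by (simp add: P_def)
  note Ppos = pos_mat_mult_vec_pos[OF P _ m[folded P_def]]
  define w where "w = P *\<^sub>v u"
  have w: "w \<in> carrier_vec n" using P u by (simp add: w_def)
  have wpos: "0 < w $ i" if "i < n" for i
    unfolding w_def using Ppos u nonneg that by blast
  show eq: "B *\<^sub>v u = real_spectral_radius B \<cdot>\<^sub>v u"
  proof (rule ccontr)
    assume neq: "\<not> ?thesis"
    define z where "z = B *\<^sub>v u - r \<cdot>\<^sub>v u"
    have z: "z \<in> carrier_vec n" using B u by (simp add: z_def)
    have "z \<noteq> 0\<^sub>v n"
    proof
      assume z0: "z = 0\<^sub>v n"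
      have "B *\<^sub>v u = r \<cdot>\<^sub>v u"
      proof (rule eq_vecI)
        fix i assume i: "i < dim_vec (r \<cdot>\<^sub>v u)"
        have "z $ i = 0" using z0 i u by simp
        then show "(B *\<^sub>v u) $ i = (r \<cdot>\<^sub>v u) $ i" using i B u by (simp add: z_def)
      qed (use B u in auto)
      then show False using neq by (simp add: r_def)
    qed
    moreover have "0 \<le> z $ i" if "i < n" for i
      using le[OF that] that B u by (simp add: z_def r_def)
    ultimately have Pz: "0 < (P *\<^sub>v z) $ i" if "i < n" for i
      using Ppos z that by blast
    have "P *\<^sub>v z = P *\<^sub>v (B *\<^sub>v u) - P *\<^sub>v (r \<cdot>\<^sub>v u)"
      unfolding z_def using P B u by (intro mult_minus_distrib_mat_vec) auto
    also have "P *\<^sub>v (B *\<^sub>v u) = B *\<^sub>v w"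
      unfolding w_def using assoc_mult_mat_vec[OF P B u(1)] assoc_mult_mat_vec[OF B P u(1)]
        pow_mat_comm[OF B] by (simp add: P_def)
    also have "P *\<^sub>v (r \<cdot>\<^sub>v u) = r \<cdot>\<^sub>v w"
      unfolding w_def by (rule mult_mat_vec[OF P u(1)])
    finally have gt: "r * w $ i < (B *\<^sub>v w) $ i" if "i < n" for i
      using Pz[OF that] that w B by simp
    define s where "s = Min ((\<lambda>i. (B *\<^sub>v w) $ i / w $ i) ` {..<n})"
    have "s \<in> (\<lambda>i. (B *\<^sub>v w) $ i / w $ i) ` {..<n}"
      unfolding s_def using n by (intro Min_in) auto
    then have "r < s" using gt wpos by (auto simp: field_simps)
    moreover have "s \<le> real_spectral_radius B"
    proof (rule le_spectral_radius_of_le_mult_vec[OF B n w Bn wpos])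
      fix i assume i: "i < n"
      then have "s \<le> (B *\<^sub>v w) $ i / w $ i" unfolding s_def by (intro Min_le) auto
      then show "s * w $ i \<le> (B *\<^sub>v w) $ i" using wpos[OF i] by (simp add: field_simps)
    qed
    ultimately show False by (simp add: r_def)
  qed
  fix i assume i: "i < n"
  have "eigenvector B u r" using eq u B by (simp add: eigenvector_def r_def)
  then have "w = r ^ m \<cdot>\<^sub>v u" unfolding w_def P_def by (rule eigenvector_pow[OF B])
  then have "0 < r ^ m * u $ i" using wpos[OF i] i u by simp
  then show "0 < u $ i" using nonneg[OF i] by (metis less_eq_real_def mult_zero_right)
qed

text \<open>By the triangle inequality, the entrywise modulus \<open>u\<close> of \<open>v\<close> satisfies \<open>B u \<ge> r u\<close>
  for the spectral radius \<open>r\<close>, so \<open>primitive_subinvariant\<close> applies to \<open>u\<close>.\<close>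

lemma primitive_peripheral_eigenvector:
  fixes B :: "real mat"
  assumes B: "B \<in> carrier_mat n n" and n: "n > 0" and prim: "primitive_mat B"
    and v: "v \<in> carrier_vec n" "v \<noteq> 0\<^sub>v n"
    and eig: "map_mat complex_of_real B *\<^sub>v v = e \<cdot>\<^sub>v v"
    and e: "norm e = real_spectral_radius B"
  shows "B *\<^sub>v map_vec norm v = real_spectral_radius B \<cdot>\<^sub>v map_vec norm v"
    and "\<And>i. i < n \<Longrightarrow> v $ i \<noteq> 0"
proof -
  let ?u = "map_vec norm v"
  have Bn: "\<And>i j. i < n \<Longrightarrow> j < n \<Longrightarrow> 0 \<le> B $$ (i, j)"
    using prim B by (auto simp: primitive_mat_def)
  have u: "?u \<in> carrier_vec n" using v by simp
  have u0: "?u \<noteq> 0\<^sub>v n"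
  proof
    assume u0: "?u = 0\<^sub>v n"
    have "v $ i = 0" if "i < n" for i
      using arg_cong[OF u0, of "\<lambda>x. x $ i"] that v by simp
    then show False using v by (auto intro: eq_vecI)
  qed
  have nn: "0 \<le> ?u $ i" if "i < n" for i using that v by simp
  have le: "real_spectral_radius B * ?u $ i \<le> (B *\<^sub>v ?u) $ i" if i: "i < n" for i
  proof -
    have "real_spectral_radius B * ?u $ i = norm ((e \<cdot>\<^sub>v v) $ i)"
      using i v by (simp add: norm_mult e)
    also have "\<dots> = norm (\<Sum>j = 0..<n. complex_of_real (B $$ (i, j)) * v $ j)"
      using i v B unfolding eig[symmetric] by (simp add: scalar_prod_def)
    also have "\<dots> \<le> (\<Sum>j = 0..<n. norm (complex_of_real (B $$ (i, j)) * v $ j))"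
      by (rule norm_sum)
    also have "\<dots> = (B *\<^sub>v ?u) $ i"
      using i v B Bn by (auto simp: scalar_prod_def norm_mult intro!: sum.cong)
    finally show ?thesis .
  qed
  show "B *\<^sub>v ?u = real_spectral_radius B \<cdot>\<^sub>v ?u"
    by (rule primitive_subinvariant(1)[OF B n prim u u0 nn le])
  show "v $ i \<noteq> 0" if "i < n" for i
    using primitive_subinvariant(2)[OF B n prim u u0 nn le that] that v by auto
qed

lemma primitive_perron_vector:
  fixes B :: "real mat"
  assumes B: "B \<in> carrier_mat n n" and n: "n > 0" and prim: "primitive_mat B"
  obtains x where "x \<in> carrier_vec n" "\<And>i. i < n \<Longrightarrow> 0 < x $ i"
    "B *\<^sub>v x = real_spectral_radius B \<cdot>\<^sub>v x"
proof -
  let ?C = "map_mat complex_of_real B"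
  have "real_spectral_radius B \<in> norm ` spectrum ?C"
    using B n by (intro spectral_radius_mem_max) auto
  then obtain e where e: "eigenvalue ?C e" "norm e = real_spectral_radius B"
    by (auto simp: spectrum_def)
  then obtain v where v: "v \<in> carrier_vec n" "v \<noteq> 0\<^sub>v n" "?C *\<^sub>v v = e \<cdot>\<^sub>v v"
    using B by (auto simp: eigenvalue_def eigenvector_def)
  note per = primitive_peripheral_eigenvector[OF B n prim v e(2)]
  show ?thesis
    by (rule that[of "map_vec norm v"]) (use v per in auto)
qed

text \<open>The vector \<open>z = v - c x\<close>, with \<open>c\<close> chosen to make its first entry zero, satisfies the eigenvalue
  equation for the spectral radius.  Eigenvectors for this eigenvalue have no zero entries, so
  \<open>z = 0\<close>.\<close>

lemma primitive_perron_vector_unique: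
  fixes B :: "real mat"
  assumes B: "B \<in> carrier_mat n n" and n: "n > 0" and prim: "primitive_mat B"
    and x: "x \<in> carrier_vec n" "\<And>i. i < n \<Longrightarrow> 0 < x $ i"
      "B *\<^sub>v x = real_spectral_radius B \<cdot>\<^sub>v x"
    and v: "v \<in> carrier_vec n"
      "map_mat complex_of_real B *\<^sub>v v = complex_of_real (real_spectral_radius B) \<cdot>\<^sub>v v"
  shows "v = (v $ 0 / complex_of_real (x $ 0)) \<cdot>\<^sub>v map_vec complex_of_real x"
proof -
  let ?C = "map_mat complex_of_real B" and ?x = "map_vec complex_of_real x"
  let ?r = "complex_of_real (real_spectral_radius B)"
  define c where "c = v $ 0 / complex_of_real (x $ 0)"
  define z where "z = v - c \<cdot>\<^sub>v ?x"
  have z: "z \<in> carrier_vec n" using v x by (simp add: z_def)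
  have C: "?C \<in> carrier_mat n n" using B by simp
  have xc: "?x \<in> carrier_vec n" using x by simp
  have Cx: "?C *\<^sub>v ?x = ?r \<cdot>\<^sub>v ?x"
    using arg_cong[OF x(3), of "map_vec complex_of_real"]
    by (simp add: of_real_hom.mult_mat_vec_hom[OF B x(1)] of_real_hom.vec_hom_smult)
  have "?C *\<^sub>v z = ?C *\<^sub>v v - ?C *\<^sub>v (c \<cdot>\<^sub>v ?x)"
    unfolding z_def using C v xc by (intro mult_minus_distrib_mat_vec) auto
  also have "\<dots> = ?r \<cdot>\<^sub>v v - c \<cdot>\<^sub>v (?r \<cdot>\<^sub>v ?x)"
    using mult_mat_vec[OF C xc] v Cx by simp
  also have "\<dots> = ?r \<cdot>\<^sub>v z"
    using v x by (intro eq_vecI) (auto simp: z_def algebra_simps)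
  finally have Cz: "?C *\<^sub>v z = ?r \<cdot>\<^sub>v z" .
  have "z $ 0 = 0" using n v x(1) x(2)[OF n] by (simp add: z_def c_def)
  then have "z = 0\<^sub>v n"
    using primitive_peripheral_eigenvector(2)[OF B n prim z _ Cz _ n]
      real_spectral_radius_nonneg[OF B n] by auto
  have "v = c \<cdot>\<^sub>v ?x"
  proof (rule eq_vecI)
    fix i assume i: "i < dim_vec (c \<cdot>\<^sub>v ?x)"
    have "z $ i = 0" using \<open>z = 0\<^sub>v n\<close> i x by simp
    then show "v $ i = (c \<cdot>\<^sub>v ?x) $ i" using i x v by (simp add: z_def)
  qed (use v x in auto)
  then show ?thesis by (simp add: c_def)
qed

section \<open>Eigenvectors of dual matrices\<close>

text \<open>The matrix \<open>B - r\<close> is singular, but subtracting the rank-one matrix \<open>x y\<^sup>T\<close>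
  makes it invertible: pairing with \<open>y\<close> shows that a vector in the kernel of the difference is
  orthogonal to \<open>y\<close>, so it lies in the kernel of \<open>B - r\<close>, hence is a multiple of \<open>x\<close>, hence
  zero as \<open>y \<bullet> x \<noteq> 0\<close>.  The same
  pairing shows that the solution for \<open>w\<close> is orthogonal to \<open>y\<close>, so that the correction term
  vanishes on it.\<close>

lemma simple_eigenvalue_solvable:
  fixes B :: "'a :: field mat"
  assumes B: "B \<in> carrier_mat n n"
    and x: "x \<in> carrier_vec n" "B *\<^sub>v x = r \<cdot>\<^sub>v x"
    and y: "y \<in> carrier_vec n" "transpose_mat B *\<^sub>v y = r \<cdot>\<^sub>v y"
    and yx: "y \<bullet> x \<noteq> 0"
    and simple: "\<And>v. v \<in> carrier_vec n \<Longrightarrow> B *\<^sub>v v = r \<cdot>\<^sub>v v \<Longrightarrow> \<exists>c. v = c \<cdot>\<^sub>v x"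
    and w: "w \<in> carrier_vec n" "y \<bullet> w = 0"
  obtains v where "v \<in> carrier_vec n" "B *\<^sub>v v = r \<cdot>\<^sub>v v + w"
proof -
  define N where "N = mat n n (\<lambda>(i, j). B $$ (i, j) - (if i = j then r else 0) - x $ i * y $ j)"
  have N: "N \<in> carrier_mat n n" by (simp add: N_def)
  have Nv: "N *\<^sub>v v = B *\<^sub>v v - r \<cdot>\<^sub>v v - (y \<bullet> v) \<cdot>\<^sub>v x" if v: "v \<in> carrier_vec n" for v
  proof (rule eq_vecI)
    fix i assume "i < dim_vec (B *\<^sub>v v - r \<cdot>\<^sub>v v - (y \<bullet> v) \<cdot>\<^sub>v x)"
    then have i: "i < n" using x by simp
    have "(N *\<^sub>v v) $ i = (\<Sum>j = 0..<n. B $$ (i, j) * v $ j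
        - (if i = j then r * v $ j else 0) - x $ i * (y $ j * v $ j))"
      using i v N by (auto simp: N_def scalar_prod_def algebra_simps intro!: sum.cong)
    also have "\<dots> = (B *\<^sub>v v - r \<cdot>\<^sub>v v - (y \<bullet> v) \<cdot>\<^sub>v x) $ i"
      using i v x y B
      by (simp add: sum_subtractf scalar_prod_def sum_distrib_left[symmetric] mult.commute)
    finally show "(N *\<^sub>v v) $ i = (B *\<^sub>v v - r \<cdot>\<^sub>v v - (y \<bullet> v) \<cdot>\<^sub>v x) $ i" .
  qed (use N x in auto)
  have yN: "y \<bullet> (N *\<^sub>v v) = - (y \<bullet> x) * (y \<bullet> v)" if v: "v \<in> carrier_vec n" for v
  proof -
    have "y \<bullet> (B *\<^sub>v v) = r * (y \<bullet> v)"
      using transpose_vec_mult_scalar[OF B v y(1)] v y by simp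
    moreover have "y \<bullet> (N *\<^sub>v v) = y \<bullet> (B *\<^sub>v v) - r * (y \<bullet> v) - (y \<bullet> v) * (y \<bullet> x)"
      unfolding Nv[OF v] using v x y B
      by (subst scalar_prod_minus_distrib[of _ n], auto)+
    ultimately show ?thesis by simp
  qed
  have "det N \<noteq> 0"
  proof
    assume "det N = 0"
    then obtain v where v: "v \<in> carrier_vec n" "v \<noteq> 0\<^sub>v n" "N *\<^sub>v v = 0\<^sub>v n"
      using det_0_iff_vec_prod_zero_field[OF N] by auto
    have yv: "y \<bullet> v = 0" using yN[OF v(1)] v(3) yx y by simp
    have "B *\<^sub>v v = r \<cdot>\<^sub>v v"
    proof (rule eq_vecI)
      fix i assume i: "i < dim_vec (r \<cdot>\<^sub>v v)"
      have "(N *\<^sub>v v) $ i = 0" using v i by simp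
      then show "(B *\<^sub>v v) $ i = (r \<cdot>\<^sub>v v) $ i"
        unfolding Nv[OF v(1)] yv using v i x B by simp
    qed (use B v in auto)
    then obtain c where c: "v = c \<cdot>\<^sub>v x" using simple v by blast
    then have "c * (y \<bullet> x) = 0" using yv x y by simp
    then have "v = 0\<^sub>v n" using c yx x by (auto intro: eq_vecI)
    then show False using v(2) by simp
  qed
  then obtain N' where N': "N' \<in> carrier_mat n n" "N * N' = 1\<^sub>m n"
    using det_non_zero_imp_unit[OF N, of "()"] unfolding Units_def ring_mat_def by auto
  define v where "v = N' *\<^sub>v w"
  have v: "v \<in> carrier_vec n" using N' w by (simp add: v_def)
  have Nvw: "N *\<^sub>v v = w"
    using assoc_mult_mat_vec[OF N N'(1) w(1)] N' w by (simp add: v_def)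
  then have yv: "y \<bullet> v = 0" using yN[OF v] w yx by simp
  have "B *\<^sub>v v = r \<cdot>\<^sub>v v + w"
  proof (rule eq_vecI)
    fix i assume i: "i < dim_vec (r \<cdot>\<^sub>v v + w)"
    have "(N *\<^sub>v v) $ i = w $ i" using Nvw by simp
    then show "(B *\<^sub>v v) $ i = (r \<cdot>\<^sub>v v + w) $ i"
      unfolding Nv[OF v] yv using v i x B w by (simp add: algebra_simps)
  qed (use B v w in auto)
  with v show ?thesis by (rule that)
qed

lemma scalar_prod_pos:
  fixes x y :: "real vec"
  assumes "x \<in> carrier_vec n" "y \<in> carrier_vec n" "n > 0"
    and "\<And>i. i < n \<Longrightarrow> 0 < x $ i" "\<And>i. i < n \<Longrightarrow> 0 < y $ i"
  shows "0 < x \<bullet> y"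
  using assms by (auto simp: scalar_prod_def intro!: sum_pos)

text \<open>Writing \<open>A = B + D \<epsilon>\<close>, the eigenvector \<open>x + v \<epsilon>\<close> with eigenvalue \<open>r + q \<epsilon>\<close> is determined by
  \<open>B x = r x\<close> and \<open>B v = r v + (q x - D x)\<close>.  The second equation forces
  \<open>q = (y \<bullet> D x) / (y \<bullet> x)\<close>, where \<open>y\<close> is a left eigenvector of \<open>B\<close>, and is solvable for this \<open>q\<close>.\<close>

lemma dual_perron_vector:
  fixes A :: "real dual mat"
  assumes A: "A \<in> carrier_mat n n" and n: "n > 0" and prim: "primitive_mat (map_mat std_part A)"
  obtains x l where "x \<in> carrier_vec n" "positive_dual_vec x" "A *\<^sub>v x = l \<cdot>\<^sub>v x"
    "std_part l = real_spectral_radius (map_mat std_part A)"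
proof -
  define B where "B = map_mat std_part A"
  define D where "D = map_mat dual_part A"
  define r where "r = real_spectral_radius B"
  have B: "B \<in> carrier_mat n n" and D: "D \<in> carrier_mat n n" using A by (simp_all add: B_def D_def)
  have Bt: "transpose_mat B \<in> carrier_mat n n" using B by simp
  note prim = prim[folded B_def]
  obtain x where x: "x \<in> carrier_vec n" "\<And>i. i < n \<Longrightarrow> 0 < x $ i" "B *\<^sub>v x = r \<cdot>\<^sub>v x"
    using primitive_perron_vector[OF B n prim] unfolding r_def by blast
  obtain y r' where y: "y \<in> carrier_vec n" "\<And>i. i < n \<Longrightarrow> 0 < y $ i"
      "transpose_mat B *\<^sub>v y = r' \<cdot>\<^sub>v y"
    using primitive_perron_vector[OF Bt n primitive_mat_transpose[OF prim]] by blast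
  have yx: "0 < y \<bullet> x" using scalar_prod_pos[OF y(1) x(1) n y(2) x(2)] .
  \<comment> \<open>\<open>r'\<close> is the spectral radius of the transpose; evaluating \<open>y \<bullet> B x\<close> in two ways gives
    \<open>r' = r\<close>.\<close>
  have "r' * (y \<bullet> x) = r * (y \<bullet> x)"
    using transpose_vec_mult_scalar[OF B x(1) y(1)] x y by simp
  then have "r' = r" using yx by simp
  note y = y[unfolded this]
  \<comment> \<open>The kernel is one-dimensional over the reals because it is so over the complex numbers.\<close>
  have simple: "\<exists>c. v = c \<cdot>\<^sub>v x" if v: "v \<in> carrier_vec n" "B *\<^sub>v v = r \<cdot>\<^sub>v v" for v
  proof
    have "map_vec complex_of_real v
        = (map_vec complex_of_real v $ 0 / complex_of_real (x $ 0)) \<cdot>\<^sub>v map_vec complex_of_real x"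
    proof (rule primitive_perron_vector_unique[OF B n prim x(1,2) x(3)[unfolded r_def]])
      show "map_mat complex_of_real B *\<^sub>v map_vec complex_of_real v
          = complex_of_real (real_spectral_radius B) \<cdot>\<^sub>v map_vec complex_of_real v"
        using arg_cong[OF v(2), of "map_vec complex_of_real"]
        by (simp add: of_real_hom.mult_mat_vec_hom[OF B v(1)] of_real_hom.vec_hom_smult r_def)
    qed (use v in auto)
    also have "\<dots> = map_vec complex_of_real ((v $ 0 / x $ 0) \<cdot>\<^sub>v x)"
      using n v by (simp add: of_real_hom.vec_hom_smult)
    finally show "v = (v $ 0 / x $ 0) \<cdot>\<^sub>v x" by (rule of_real_hom.vec_hom_inj)
  qed
  define q where "q = (y \<bullet> (D *\<^sub>v x)) / (y \<bullet> x)"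
  define w where "w = q \<cdot>\<^sub>v x - D *\<^sub>v x"
  have w: "w \<in> carrier_vec n" using D x by (simp add: w_def)
  have "y \<bullet> w = q * (y \<bullet> x) - y \<bullet> (D *\<^sub>v x)"
    unfolding w_def using x y D by (subst scalar_prod_minus_distrib[of _ n]) auto
  then have "y \<bullet> w = 0" using yx by (simp add: q_def)
  then obtain v where v: "v \<in> carrier_vec n" "B *\<^sub>v v = r \<cdot>\<^sub>v v + w"
    using simple_eigenvalue_solvable[OF B x(1,3) y(1,3) _ simple w] yx by (metis less_irrefl)
  define X where "X = vec n (\<lambda>i. Dual (x $ i) (v $ i))"
  have X: "X \<in> carrier_vec n" by (simp add: X_def)
  have Xs: "map_vec std_part X = x" and Xd: "map_vec dual_part X = v"
    using x v by (auto simp: X_def)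
  have std: "map_vec std_part (A *\<^sub>v X) = r \<cdot>\<^sub>v x"
    unfolding std_part_hom.mult_mat_vec_hom[OF A X] Xs using x by (simp add: B_def)
  have dual: "map_vec dual_part (A *\<^sub>v X) = r \<cdot>\<^sub>v v + q \<cdot>\<^sub>v x"
    unfolding dual_part_mult_mat_vec[OF A X] Xs Xd B_def[symmetric] D_def[symmetric] v(2)
    using v x D by (intro eq_vecI) (auto simp: w_def)
  have "A *\<^sub>v X = Dual r q \<cdot>\<^sub>v X"
  proof (rule eq_vecI)
    fix i assume "i < dim_vec (Dual r q \<cdot>\<^sub>v X)"
    then have i: "i < n" by (simp add: X_def)
    have "std_part ((A *\<^sub>v X) $ i) = r * x $ i"
      using arg_cong[OF std, of "\<lambda>u. u $ i"] i A x by simp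
    moreover have "dual_part ((A *\<^sub>v X) $ i) = r * v $ i + q * x $ i"
      using arg_cong[OF dual, of "\<lambda>u. u $ i"] i A x v by simp
    ultimately show "(A *\<^sub>v X) $ i = (Dual r q \<cdot>\<^sub>v X) $ i"
      using i by (intro dual.expand) (auto simp: X_def)
  qed (use A in \<open>simp add: X_def\<close>)
  moreover have "positive_dual_vec X" using x(2) by (simp add: positive_dual_vec_def X_def)
  moreover have "std_part (Dual r q) = real_spectral_radius (map_mat std_part A)"
    by (simp only: dual.sel r_def B_def)
  ultimately show ?thesis using that[OF X] by blast
qed

lemma std_part_scalar_prod:
  fixes x y :: "'a :: comm_ring_1 dual vec"
  assumes "x \<in> carrier_vec n" "y \<in> carrier_vec n"
  shows "std_part (x \<bullet> y) = map_vec std_part x \<bullet> map_vec std_part y"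
  unfolding scalar_prod_def std_part_hom.hom_sum
  using assms by (intro sum.cong) auto

lemma std_part_scalar_prod_pos:
  assumes x: "x \<in> carrier_vec n" "positive_dual_vec x" and y: "y \<in> carrier_vec n" "positive_dual_vec y"
    and n: "n > 0"
  shows "0 < std_part (y \<bullet> x)"
  unfolding std_part_scalar_prod[OF y(1) x(1)]
  using assms by (intro scalar_prod_pos[of _ n]) (auto simp: positive_dual_vec_def)

section \<open>Collatz--Wielandt bounds and the Perron eigenvalue\<close>

text \<open>Pairing the componentwise inequalities with the positive left eigenvector \<open>y\<close> turns them into
  a comparison of \<open>m (y \<bullet> x)\<close> with \<open>y \<bullet> A x = l (y \<bullet> x)\<close>.\<close>

lemma positive_vec_le_mult_imp_le:
  fixes A :: "real dual mat"
  assumes A: "A \<in> carrier_mat n n" and n: "n > 0"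
    and y: "y \<in> carrier_vec n" "positive_dual_vec y" "transpose_mat A *\<^sub>v y = l \<cdot>\<^sub>v y"
    and x: "x \<in> carrier_vec n" "positive_dual_vec x"
  shows "(\<And>i. i < n \<Longrightarrow> m * x $ i \<le> (A *\<^sub>v x) $ i) \<Longrightarrow> m \<le> l"
    and "(\<And>i. i < n \<Longrightarrow> (A *\<^sub>v x) $ i \<le> m * x $ i) \<Longrightarrow> l \<le> m"
proof -
  have yAx: "y \<bullet> (A *\<^sub>v x) = l * (y \<bullet> x)"
    using transpose_vec_mult_scalar[OF A x(1) y(1)] x y by simp
  have pos: "0 < std_part (y \<bullet> x)" by (rule std_part_scalar_prod_pos[OF x y(1,2) n])
  have y0: "0 \<le> y $ i" if "i < n" for i
    using y that by (auto simp: positive_dual_vec_def intro: std_part_pos_imp_nonneg)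
  have myx: "m * (y \<bullet> x) = (\<Sum>i = 0..<n. y $ i * (m * x $ i))"
    using x by (simp add: scalar_prod_def sum_distrib_left mult_ac)
  have Ax: "y \<bullet> (A *\<^sub>v x) = (\<Sum>i = 0..<n. y $ i * (A *\<^sub>v x) $ i)"
    using A by (simp add: scalar_prod_def)
  show "m \<le> l" if "\<And>i. i < n \<Longrightarrow> m * x $ i \<le> (A *\<^sub>v x) $ i"
  proof (rule dual_le_of_mult_right_le[OF _ pos])
    show "m * (y \<bullet> x) \<le> l * (y \<bullet> x)"
      unfolding yAx[symmetric] myx Ax using that y0 by (intro sum_mono mult_left_mono) auto
  qed
  show "l \<le> m" if "\<And>i. i < n \<Longrightarrow> (A *\<^sub>v x) $ i \<le> m * x $ i"
  proof (rule dual_le_of_mult_right_le[OF _ pos])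
    show "l * (y \<bullet> x) \<le> m * (y \<bullet> x)"
      unfolding yAx[symmetric] myx Ax using that y0 by (intro sum_mono mult_left_mono) auto
  qed
qed

lemma collatz_wielandt_bounds:
  fixes A :: "real dual mat"
  assumes A: "A \<in> carrier_mat n n" and n: "n > 0"
    and y: "y \<in> carrier_vec n" "positive_dual_vec y" "transpose_mat A *\<^sub>v y = l \<cdot>\<^sub>v y"
    and x: "x \<in> carrier_vec n" "positive_dual_vec x"
  shows "min_ratio A x \<le> l" "l \<le> max_ratio A x"
proof -
  have xi: "0 \<le> x $ i" "(A *\<^sub>v x) $ i / x $ i * x $ i = (A *\<^sub>v x) $ i" if "i < n" for i
  proof -
    have p: "0 < std_part (x $ i)" using x that by (simp add: positive_dual_vec_def)
    show "0 \<le> x $ i" by (rule std_part_pos_imp_nonneg[OF p])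
    show "(A *\<^sub>v x) $ i / x $ i * x $ i = (A *\<^sub>v x) $ i"
      by (rule dual_divide_times) (use p in simp)
  qed
  note collatz = positive_vec_le_mult_imp_le[OF A n y x]
  show "min_ratio A x \<le> l"
  proof (rule collatz(1))
    fix i assume i: "i < n"
    then have "min_ratio A x \<le> (A *\<^sub>v x) $ i / x $ i"
      using x unfolding min_ratio_def by (intro Min_le) auto
    from mult_right_mono[OF this xi(1)[OF i]] xi(2)[OF i]
    show "min_ratio A x * x $ i \<le> (A *\<^sub>v x) $ i" by simp
  qed
  show "l \<le> max_ratio A x"
  proof (rule collatz(2))
    fix i assume i: "i < n"
    then have "(A *\<^sub>v x) $ i / x $ i \<le> max_ratio A x"
      using x unfolding max_ratio_def by (intro Max_ge) auto
    from mult_right_mono[OF this xi(1)[OF i]] xi(2)[OF i]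
    show "(A *\<^sub>v x) $ i \<le> max_ratio A x * x $ i" by simp
  qed
qed

lemma ratio_eigenvector:
  fixes A :: "real dual mat"
  assumes x: "x \<in> carrier_vec n" "positive_dual_vec x" "A *\<^sub>v x = l \<cdot>\<^sub>v x" and n: "n > 0"
  shows "min_ratio A x = l" "max_ratio A x = l"
proof -
  have "(A *\<^sub>v x) $ i / x $ i = l" if i: "i < n" for i
  proof -
    have p: "std_part (x $ i) \<noteq> 0" using x i by (auto simp: positive_dual_vec_def)
    have "(A *\<^sub>v x) $ i / x $ i * x $ i = l * x $ i"
      unfolding x(3) using dual_divide_times[OF p] i x by simp
    then show ?thesis using p by (rule dual_mult_right_cancel)
  qed
  then have "(\<lambda>i. (A *\<^sub>v x) $ i / x $ i) ` {..<dim_vec x} = {l}" using n x by force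
  then show "min_ratio A x = l" "max_ratio A x = l" by (simp_all add: min_ratio_def max_ratio_def)
qed

text \<open>Uniqueness among all dual complex eigenvalues \<open>\<mu>\<close> with the same standard part: pair an eigenvector
  \<open>z\<close> for \<open>\<mu>\<close> with the left eigenvector \<open>y\<close> to get \<open>l (y \<bullet> z) = \<mu> (y \<bullet> z)\<close>.  The factor
  \<open>y \<bullet> z\<close> is cancellable because the standard part of \<open>z\<close> is a nonzero multiple of that
  of \<open>x\<close>.\<close>

lemma perron_eigenvalue_eqI:
  fixes A :: "real dual mat"
  assumes A: "A \<in> carrier_mat n n" and n: "n > 0" and prim: "primitive_mat (map_mat std_part A)"
    and x: "x \<in> carrier_vec n" "positive_dual_vec x" "A *\<^sub>v x = l \<cdot>\<^sub>v x"
    and l: "std_part l = real_spectral_radius (map_mat std_part A)"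
    and y: "y \<in> carrier_vec n" "positive_dual_vec y" "transpose_mat A *\<^sub>v y = l \<cdot>\<^sub>v y"
  shows "perron_eigenvalue A = l"
proof -
  let ?A = "map_mat complex_dual A" and ?B = "map_mat std_part A"
  let ?r = "real_spectral_radius ?B"
  let ?S = "{\<mu>. dual_eigenvalue ?A \<mu> \<and> std_part \<mu> = complex_of_real ?r}"
  have Ac: "?A \<in> carrier_mat n n" and B: "?B \<in> carrier_mat n n" using A by simp_all
  have AB: "map_mat std_part ?A = map_mat complex_of_real ?B"
    by (intro eq_matI) (auto simp: dual.map_sel)
  define xs where "xs = map_vec std_part x"
  have xs: "xs \<in> carrier_vec n" "\<And>i. i < n \<Longrightarrow> 0 < xs $ i"
    using x(1,2) by (auto simp: xs_def positive_dual_vec_def)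
  have Bxs: "?B *\<^sub>v xs = ?r \<cdot>\<^sub>v xs"
    unfolding xs_def l[symmetric] std_part_hom.mult_mat_vec_hom[OF A x(1), symmetric] x(3)
    by (rule std_part_hom.vec_hom_smult)
  have "complex_dual l \<in> ?S"
  proof -
    have "map_vec std_part (map_vec complex_dual x) \<noteq> 0\<^sub>v n"
    proof
      assume "map_vec std_part (map_vec complex_dual x) = 0\<^sub>v n"
      from arg_cong[OF this, of "\<lambda>u. u $ 0"] xs(2)[OF n] n x show False
        by (simp add: xs_def dual.map_sel)
    qed
    moreover have "?A *\<^sub>v map_vec complex_dual x = complex_dual l \<cdot>\<^sub>v map_vec complex_dual x"
      using arg_cong[OF x(3), of "map_vec complex_dual"]
      by (simp add: complex_dual_hom.mult_mat_vec_hom[OF A x(1)] complex_dual_hom.vec_hom_smult)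
    ultimately have "dual_eigenvalue ?A (complex_dual l)"
      using x A unfolding dual_eigenvalue_def by (intro bexI[of _ "map_vec complex_dual x"]) auto
    then show ?thesis using l by (simp add: dual.map_sel)
  qed
  moreover have "\<mu> = complex_dual l" if \<mu>: "\<mu> \<in> ?S" for \<mu>
  proof -
    obtain z where z: "z \<in> carrier_vec n" "map_vec std_part z \<noteq> 0\<^sub>v n" "?A *\<^sub>v z = \<mu> \<cdot>\<^sub>v z"
      using \<mu> A by (auto simp: dual_eigenvalue_def)
    define zs where "zs = map_vec std_part z"
    have zs: "zs \<in> carrier_vec n" using z by (simp add: zs_def)
    have "map_mat complex_of_real ?B *\<^sub>v zs = complex_of_real ?r \<cdot>\<^sub>v zs"
      using arg_cong[OF z(3), of "map_vec std_part"] \<mu>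
      by (simp add: zs_def std_part_hom.mult_mat_vec_hom[OF Ac z(1)] std_part_hom.vec_hom_smult AB)
    from primitive_perron_vector_unique[OF B n prim xs Bxs zs this]
    obtain c where c: "zs = c \<cdot>\<^sub>v map_vec complex_of_real xs" by blast
    have "c \<noteq> 0" using c z(2) xs by (auto simp: zs_def)
    let ?y = "map_vec complex_dual y"
    have yc: "?y \<in> carrier_vec n" using y by simp
    have "std_part (?y \<bullet> z) = map_vec std_part ?y \<bullet> zs"
      unfolding zs_def by (rule std_part_scalar_prod[OF yc z(1)])
    also have "\<dots> = c * complex_of_real (std_part (y \<bullet> x))"
      unfolding c std_part_scalar_prod[OF y(1) x(1)] xs_def
      using x y by (simp add: scalar_prod_def dual.map_sel sum_distrib_left mult_ac)
    finally have nz: "std_part (?y \<bullet> z) \<noteq> 0"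
      using \<open>c \<noteq> 0\<close> std_part_scalar_prod_pos[OF x(1,2) y(1,2) n] by simp
    have "transpose_mat ?A *\<^sub>v ?y = map_vec complex_dual (transpose_mat A *\<^sub>v y)"
      using complex_dual_hom.mult_mat_vec_hom[of "transpose_mat A" n n y] A y(1)
      by (simp add: map_mat_transpose)
    also have "\<dots> = complex_dual l \<cdot>\<^sub>v ?y" unfolding y(3) by (rule complex_dual_hom.vec_hom_smult)
    finally have "complex_dual l * (?y \<bullet> z) = \<mu> * (?y \<bullet> z)"
      using transpose_vec_mult_scalar[OF Ac z(1) yc] z y by simp
    then show ?thesis using nz by (metis dual_mult_right_cancel)
  qed
  ultimately have S: "?S = {complex_dual l}" by blast
  show ?thesis
    unfolding perron_eigenvalue_def
  proof (rule the_equality)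
    show "?S = {complex_dual l}" by (rule S)
  next
    fix k assume "?S = {complex_dual k}"
    then have "complex_dual k = complex_dual l" using S by simp
    then show "k = l" by (cases k; cases l) simp
  qed
qed

theorem theorem4p2:
  fixes n :: nat and A :: "real dual mat" and l :: "real dual"
  assumes "n > 0"
    and "A \<in> carrier_mat n n"
    and "primitive_mat (map_mat std_part A)"
    and "l = perron_eigenvalue A"
  shows "(\<forall>x \<in> carrier_vec n. positive_dual_vec x \<longrightarrow> min_ratio A x \<le> l \<and> l \<le> max_ratio A x)
    \<and> is_maximum {min_ratio A x | x. x \<in> carrier_vec n \<and> positive_dual_vec x} l
    \<and> is_minimum {max_ratio A x | x. x \<in> carrier_vec n \<and> positive_dual_vec x} l"
proof -
  note n = assms(1) and A = assms(2) and prim = assms(3)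
  obtain x k where x: "x \<in> carrier_vec n" "positive_dual_vec x" "A *\<^sub>v x = k \<cdot>\<^sub>v x"
    and k: "std_part k = real_spectral_radius (map_mat std_part A)"
    by (rule dual_perron_vector[OF A n prim])
  have "primitive_mat (map_mat std_part (transpose_mat A))"
    using primitive_mat_transpose[OF prim] by (simp add: map_mat_transpose)
  with A n obtain y k' where y: "y \<in> carrier_vec n" "positive_dual_vec y"
    "transpose_mat A *\<^sub>v y = k' \<cdot>\<^sub>v y"
    using dual_perron_vector[of "transpose_mat A" n] by (metis transpose_carrier_mat)
  \<comment> \<open>The Perron vectors of \<open>A\<close> and its transpose belong to the same dual eigenvalue.\<close>
  have "k' * (y \<bullet> x) = k * (y \<bullet> x)"
    using transpose_vec_mult_scalar[OF A x(1) y(1)] x y by simp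
  then have "k' = k"
    using std_part_scalar_prod_pos[OF x(1,2) y(1,2) n] by (metis dual_mult_right_cancel less_irrefl)
  note y = y[unfolded this]
  have l: "l = k" unfolding assms(4) by (rule perron_eigenvalue_eqI[OF A n prim x k y])
  have bounds: "min_ratio A u \<le> l" "l \<le> max_ratio A u"
    if "u \<in> carrier_vec n" "positive_dual_vec u" for u
    using collatz_wielandt_bounds[OF A n y that] l by simp_all
  have attained: "l = min_ratio A x" "l = max_ratio A x"
    using ratio_eigenvector[OF x n] l by simp_all
  show ?thesis
    unfolding is_maximum_def is_minimum_def
  proof (intro conjI)
    show "l \<in> {min_ratio A x | x. x \<in> carrier_vec n \<and> positive_dual_vec x}"
      using x(1,2) attained(1) by blast
    show "l \<in> {max_ratio A x | x. x \<in> carrier_vec n \<and> positive_dual_vec x}"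
      using x(1,2) attained(2) by blast
  qed (use bounds in auto)
qed

end
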